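(* Let $c\ne0$ be a real constant and consider the Codazzi-like equation $$\alpha_{xx}+6\alpha\alpha_x+4\alpha^3+c^2\alpha=0$$ for a real-valued function $\alpha=\alpha(x)$ on an open interval. Besides the trivial solution $\alpha(x)=0$, it has the special solutions $$\alpha(x)=-\tfrac12|c|\tan\big(|c|x+|c|K_1\big),\qquad \alpha(x)=\tfrac12|c|\tan\Big(-\tfrac{|c|}{2}x+\tfrac{|c|}{2}K_2\Big),\qquad K_1,K_2\in\mathbb{R},$$ and the general solution of the form $$\alpha(x)=\lambda\,\frac{\sin(2\lambda x+c_1)}{c_2-\cos(2\lambda x+c_1)},$$ which depends on two real constants $c_1$ and $c_2$, where $c=2\lambda$.
   Context: Solutions are smooth real-valued functions on an open interval. "General solution" means that every solution on an open interval is of one of the listed forms (with nonvanishing denominator on that interval), and each listed function is a solution where defined. *)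

theory Defs
  imports "HOL-Analysis.Analysis"
begin

definition open_interval :: "real set \<Rightarrow> bool" where
  "open_interval I \<longleftrightarrow> open I \<and> is_interval I \<and> I \<noteq> {}"

text \<open>Functions are total, but on an open set \<open>I\<close> the iterated derivatives depend only on the
  values of \<open>f\<close> on \<open>I\<close>; nothing is required of \<open>f\<close> outside \<open>I\<close>.\<close>

definition real_smooth_on :: "real set \<Rightarrow> (real \<Rightarrow> real) \<Rightarrow> bool" where
  "real_smooth_on I f \<longleftrightarrow> (\<forall>n. \<forall>x\<in>I. (deriv ^^ n) f field_differentiable at x)"

definition codazzi_solution_on :: "real \<Rightarrow> real set \<Rightarrow> (real \<Rightarrow> real) \<Rightarrow> bool" where
  "codazzi_solution_on c I \<alpha> \<longleftrightarrow> real_smooth_on I \<alpha> \<and>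
     (\<forall>x\<in>I. deriv (deriv \<alpha>) x + 6 * \<alpha> x * deriv \<alpha> x + 4 * \<alpha> x ^ 3 + c\<^sup>2 * \<alpha> x = 0)"

text \<open>Each of the following says that \<open>\<alpha>\<close> has the given form on \<open>I\<close> and that this form is defined
  throughout \<open>I\<close>. The condition on the denominator (for the tangent, on the cosine) is needed
  because division by zero yields zero.\<close>

definition special_form1 :: "real \<Rightarrow> real \<Rightarrow> real set \<Rightarrow> (real \<Rightarrow> real) \<Rightarrow> bool" where
  "special_form1 c K1 I \<alpha> \<longleftrightarrow>
     (\<forall>x\<in>I. cos (\<bar>c\<bar> * x + \<bar>c\<bar> * K1) \<noteq> 0 \<and>
             \<alpha> x = - (1/2) * \<bar>c\<bar> * tan (\<bar>c\<bar> * x + \<bar>c\<bar> * K1))"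

definition special_form2 :: "real \<Rightarrow> real \<Rightarrow> real set \<Rightarrow> (real \<Rightarrow> real) \<Rightarrow> bool" where
  "special_form2 c K2 I \<alpha> \<longleftrightarrow>
     (\<forall>x\<in>I. cos (- (\<bar>c\<bar> / 2) * x + (\<bar>c\<bar> / 2) * K2) \<noteq> 0 \<and>
             \<alpha> x = (1/2) * \<bar>c\<bar> * tan (- (\<bar>c\<bar> / 2) * x + (\<bar>c\<bar> / 2) * K2))"

definition general_form :: "real \<Rightarrow> real \<Rightarrow> real \<Rightarrow> real set \<Rightarrow> (real \<Rightarrow> real) \<Rightarrow> bool" where
  "general_form lam c1 c2 I \<alpha> \<longleftrightarrow>
     (\<forall>x\<in>I. c2 - cos (2 * lam * x + c1) \<noteq> 0 \<and>
             \<alpha> x = lam * (sin (2 * lam * x + c1) / (c2 - cos (2 * lam * x + c1))))"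

end

theory Submission
  imports Defs
begin

text \<open>The substitution \<open>\<alpha> = D' / (2 D)\<close> turns the equation into the linear equation
  \<open>D''' + c\<^sup>2 D' = 0\<close>, whose solutions are \<open>D = A - R cos (c x + c\<^sub>1)\<close>. Here
  \<open>D = exp (2 \<integral>\<alpha>)\<close> has no zero, and \<open>\<alpha>\<close> vanishes identically when \<open>R = 0\<close>; otherwise
  \<open>c\<^sub>2 = A / R\<close> gives the general form. The special forms come from \<open>D = cos (\<bar>c\<bar> (x + K\<^sub>1))\<close> and
  \<open>D = cos\<^sup>2 (\<bar>c\<bar> (K\<^sub>2 - x) / 2)\<close>.\<close>

section \<open>Smoothness from families closed under differentiation\<close>

text \<open>By induction, each iterated \<open>deriv\<close> of \<open>f\<close> agrees on
  \<open>I\<close> with some member of \<open>S\<close>. Openness of \<open>I\<close> is what lets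
  this agreement pass to the next derivative, since off \<open>I\<close> the functions may be
  unrelated.\<close>

lemma real_smooth_on_coinduct:
  assumes "open I" and "f \<in> S"
    and step: "\<And>f. f \<in> S \<Longrightarrow> \<exists>g\<in>S. \<forall>x\<in>I. (f has_field_derivative g x) (at x)"
  shows "real_smooth_on I f"
proof -
  have transfer: "(h has_field_derivative g' x) (at x)"
    if "\<forall>y\<in>I. h y = g y" "\<forall>y\<in>I. (g has_field_derivative g' y) (at y)" "x \<in> I" for g g' h x
    by (rule has_field_derivative_transform_within_open[of g "g' x" x I])
      (use that \<open>open I\<close> in auto)
  have "\<exists>g\<in>S. \<forall>x\<in>I. (deriv ^^ n) f x = g x" for n
  proof (induction n)
    case 0
    then show ?case using \<open>f \<in> S\<close> by auto
  next
    case (Suc n)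
    then obtain g where g: "g \<in> S" "\<forall>x\<in>I. (deriv ^^ n) f x = g x" by blast
    obtain g' where "g' \<in> S" "\<forall>x\<in>I. (g has_field_derivative g' x) (at x)"
      using step[OF g(1)] by blast
    moreover have "(deriv ^^ Suc n) f x = g' x" if "x \<in> I" for x
      using DERIV_imp_deriv[OF transfer[OF g(2) calculation(2) that]] by simp
    ultimately show ?case by blast
  qed
  then have "\<exists>g'. \<forall>x\<in>I. ((deriv ^^ n) f has_field_derivative g' x) (at x)" for n
    using step transfer by blast
  then show ?thesis
    unfolding real_smooth_on_def field_differentiable_def by blast
qed

text \<open>The real polynomials in \<open>a\<close> and \<open>b\<close>. If the derivatives of
  both generators lie in it, so do all derivatives, by the sum and product rules; it then serves as
  the family \<open>S\<close> above.\<close>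

inductive_set generated_algebra :: "(real \<Rightarrow> real) \<Rightarrow> (real \<Rightarrow> real) \<Rightarrow> (real \<Rightarrow> real) set"
  for a b where
  const: "(\<lambda>x. r) \<in> generated_algebra a b"
| left: "a \<in> generated_algebra a b"
| right: "b \<in> generated_algebra a b"
| add: "f \<in> generated_algebra a b \<Longrightarrow> g \<in> generated_algebra a b \<Longrightarrow>
    (\<lambda>x. f x + g x) \<in> generated_algebra a b"
| mult: "f \<in> generated_algebra a b \<Longrightarrow> g \<in> generated_algebra a b \<Longrightarrow>
    (\<lambda>x. f x * g x) \<in> generated_algebra a b"

lemma generated_algebra_derivative:
  assumes "f \<in> generated_algebra a b"
    and a': "a' \<in> generated_algebra a b" "\<forall>x\<in>I. (a has_field_derivative a' x) (at x)"
    and b': "b' \<in> generated_algebra a b" "\<forall>x\<in>I. (b has_field_derivative b' x) (at x)"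
  shows "\<exists>g\<in>generated_algebra a b. \<forall>x\<in>I. (f has_field_derivative g x) (at x)"
  using assms(1)
proof induction
  case (const r)
  show ?case
    by (rule bexI[OF _ generated_algebra.const[of 0]]) auto
next
  case left
  show ?case using a' by blast
next
  case right
  show ?case using b' by blast
next
  case (add f g)
  then obtain f' g' where "f' \<in> generated_algebra a b" "g' \<in> generated_algebra a b"
    "\<forall>x\<in>I. (f has_field_derivative f' x) (at x)" "\<forall>x\<in>I. (g has_field_derivative g' x) (at x)"
    by blast
  then show ?case
    by (intro bexI[of _ "\<lambda>x. f' x + g' x"]) (auto intro: DERIV_add generated_algebra.add)
next
  case (mult f g)
  then obtain f' g' where "f' \<in> generated_algebra a b" "g' \<in> generated_algebra a b"
    "\<forall>x\<in>I. (f has_field_derivative f' x) (at x)" "\<forall>x\<in>I. (g has_field_derivative g' x) (at x)"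
    by blast
  with mult.hyps show ?case
    by (intro bexI[of _ "\<lambda>x. f' x * g x + g' x * f x"])
      (auto intro: DERIV_mult generated_algebra.intros)
qed

section \<open>Criteria for being a solution\<close>

text \<open>As a first-order system the equation reads \<open>a' = b\<close>, \<open>b' =\<close> a
  polynomial in \<open>a\<close> and \<open>b\<close>. Smoothness therefore follows from the two
  derivative rules alone.\<close>

lemma codazzi_solution_onI:
  assumes "open I"
    and a: "\<And>x. x \<in> I \<Longrightarrow> (a has_field_derivative b x) (at x)"
    and b: "\<And>x. x \<in> I \<Longrightarrow>
      (b has_field_derivative - 6 * a x * b x - 4 * a x ^ 3 - c\<^sup>2 * a x) (at x)"
  shows "codazzi_solution_on c I a"
proof -
  \<comment> \<open>The prescribed derivative of \<open>b\<close>, rewritten with constants, sums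
    and products only, so that it matches the introduction rules literally.\<close>
  let ?b' = "\<lambda>x. (- 6) * (a x * b x) + ((- 4) * (a x * (a x * a x)) + (- c\<^sup>2) * a x)"
  have b'_in: "?b' \<in> generated_algebra a b"
    by (intro generated_algebra.intros)
  have b': "\<forall>x\<in>I. (b has_field_derivative ?b' x) (at x)"
  proof
    fix x assume "x \<in> I"
    have "?b' x = - 6 * a x * b x - 4 * a x ^ 3 - c\<^sup>2 * a x"
      by (simp add: power3_eq_cube)
    then show "(b has_field_derivative ?b' x) (at x)"
      using b[OF \<open>x \<in> I\<close>] by (simp only:)
  qed
  have "real_smooth_on I a"
    using \<open>open I\<close> generated_algebra.left
  proof (rule real_smooth_on_coinduct)
    show "\<exists>g\<in>generated_algebra a b. \<forall>x\<in>I. (f has_field_derivative g x) (at x)"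
      if "f \<in> generated_algebra a b" for f
      using generated_algebra_derivative[OF that generated_algebra.right _ b'_in b'] a by blast
  qed
  moreover have da: "deriv a x = b x" if "x \<in> I" for x
    using DERIV_imp_deriv[OF a[OF that]] .
  moreover have "deriv (deriv a) x = - 6 * a x * b x - 4 * a x ^ 3 - c\<^sup>2 * a x" if "x \<in> I" for x
    by (rule DERIV_imp_deriv,
        rule has_field_derivative_transform_within_open[OF b[OF that] \<open>open I\<close> that])
      (simp add: da)
  ultimately show ?thesis
    unfolding codazzi_solution_on_def by simp
qed

text \<open>From \<open>a' = D2 / (2 * D) - 2 * a^2\<close> a second differentiation gives
  \<open>a'' = D''' / (2 * D) - 2 * a * (a' + 2 * a^2) - 4 * a * a'\<close>. With
  \<open>D''' = - c^2 * D1\<close> the first term is \<open>- c^2 * a\<close>, and the equation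
  results.\<close>

lemma codazzi_solution_on_log_derivative:
  assumes "open I"
    and D: "\<And>x. x \<in> I \<Longrightarrow> (D has_field_derivative D1 x) (at x)"
    and D1: "\<And>x. x \<in> I \<Longrightarrow> (D1 has_field_derivative D2 x) (at x)"
    and D2: "\<And>x. x \<in> I \<Longrightarrow> (D2 has_field_derivative - c\<^sup>2 * D1 x) (at x)"
    and nz: "\<And>x. x \<in> I \<Longrightarrow> D x \<noteq> 0"
    and a: "\<And>x. x \<in> I \<Longrightarrow> a x = D1 x / (2 * D x)"
  shows "codazzi_solution_on c I a"
proof (rule codazzi_solution_onI[where b = "\<lambda>x. D2 x / (2 * D x) - 2 * (a x)\<^sup>2"])
  show a': "(a has_field_derivative D2 x / (2 * D x) - 2 * (a x)\<^sup>2) (at x)" if "x \<in> I" for x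
  proof -
    have "((\<lambda>x. D1 x / (2 * D x)) has_field_derivative D2 x / (2 * D x) - 2 * (a x)\<^sup>2) (at x)"
      using nz[OF that]
      by (auto intro!: derivative_eq_intros D[OF that] D1[OF that]
          simp: a[OF that] field_simps power2_eq_square)
    then show ?thesis
      by (rule has_field_derivative_transform_within_open[OF _ \<open>open I\<close> that]) (simp add: a)
  qed
  show "((\<lambda>x. D2 x / (2 * D x) - 2 * (a x)\<^sup>2) has_field_derivative
      - 6 * a x * (D2 x / (2 * D x) - 2 * (a x)\<^sup>2) - 4 * a x ^ 3 - c\<^sup>2 * a x) (at x)"
    if "x \<in> I" for x
    using nz[OF that]
    by (auto intro!: derivative_eq_intros D[OF that] D2[OF that] a'[OF that]
        simp: a[OF that] field_simps power2_eq_square power3_eq_cube)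
qed (rule \<open>open I\<close>)

section \<open>Antiderivatives and the linear oscillator\<close>

lemma continuous_on_open_interval_antiderivative:
  fixes f :: "real \<Rightarrow> real"
  assumes "open I" and "is_interval I" and cont: "continuous_on I f"
  obtains F where "\<And>x. x \<in> I \<Longrightarrow> (F has_field_derivative f x) (at x)"
proof (cases "I = {}")
  case True
  then show thesis by (intro that[of "\<lambda>x. 0"]) simp
next
  case False
  then obtain x0 where x0: "x0 \<in> I" by blast
  \<comment> \<open>The oriented integral from \<open>x0\<close> to \<open>x\<close>: at least one
    of the two intervals is empty or a single point and contributes 0.\<close>
  define F where "F x = integral {x0..x} f - integral {x..x0} f" for x
  have "(F has_field_derivative f x) (at x)" if "x \<in> I" for x
  proof -
    obtain e where e: "e > 0" "cball x e \<subseteq> I"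
      using \<open>open I\<close> \<open>x \<in> I\<close> open_contains_cball by blast
    \<comment> \<open>A compact interval inside \<open>I\<close> that contains both
      \<open>x0\<close> and a neighbourhood of \<open>x\<close>. An antiderivative \<open>G\<close>
      on it then differs from \<open>F\<close> near \<open>x\<close> only by the constant
      \<open>G x0\<close>.\<close>
    define p q where "p = min x0 (x - e)" and "q = max x0 (x + e)"
    have "p \<in> I" "q \<in> I"
      using x0 e by (auto simp: p_def q_def min_def max_def subset_iff dist_real_def)
    then have pq: "{p..q} \<subseteq> I"
      using interval_subset_is_interval[OF \<open>is_interval I\<close>, of p q] by simp
    obtain G where G: "\<And>y. y \<in> {p..q} \<Longrightarrow> (G has_vector_derivative f y) (at y within {p..q})"
      by (rule antiderivative_continuous[OF continuous_on_subset[OF cont pq]]) blast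
    have int: "integral {s..t} f = G t - G s" if "s \<le> t" "p \<le> s" "t \<le> q" for s t
    proof (rule integral_unique, rule fundamental_theorem_of_calculus[OF that(1)])
      fix y assume "y \<in> {s..t}"
      with that have "y \<in> {p..q}" "{s..t} \<subseteq> {p..q}" by auto
      then show "(G has_vector_derivative f y) (at y within {s..t})"
        using G has_vector_derivative_within_subset by blast
    qed
    have F: "F y = G y - G x0" if "y \<in> {p<..<q}" for y
    proof (cases "x0 \<le> y")
      case True
      moreover have "integral {y..x0} f = 0"
        using True by (cases "y = x0") auto
      moreover have "integral {x0..y} f = G y - G x0"
        using True that by (intro int) (auto simp: p_def)
      ultimately show ?thesis by (simp add: F_def)
    next
      case False
      moreover have "integral {y..x0} f = G x0 - G y"
        using False that by (intro int) (auto simp: q_def)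
      ultimately show ?thesis by (simp add: F_def)
    qed
    have x: "x \<in> {p<..<q}"
      using e by (auto simp: p_def q_def)
    then have "(G has_field_derivative f x) (at x within {p..q})"
      using G by (simp add: has_real_derivative_iff_has_vector_derivative)
    then have "(G has_field_derivative f x) (at x)"
      using x by (simp add: at_within_Icc_at)
    then have "((\<lambda>y. G y - G x0) has_field_derivative f x) (at x)"
      by (auto intro!: derivative_eq_intros)
    then show ?thesis
      by (rule has_field_derivative_transform_within_open[OF _ open_greaterThanLessThan x])
        (simp add: F)
  qed
  then show thesis by (rule that)
qed

text \<open>The complex number \<open>g + i f\<close> turns at constant angular speed
  \<open>c\<close>. Undoing the rotation leaves a constant, whose modulus and argument are the
  amplitude and the phase.\<close>

lemma linear_oscillator_phase_form:
  fixes f g :: "real \<Rightarrow> real"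
  assumes "open I" and "is_interval I"
    and f: "\<And>x. x \<in> I \<Longrightarrow> (f has_field_derivative c * g x) (at x)"
    and g: "\<And>x. x \<in> I \<Longrightarrow> (g has_field_derivative - c * f x) (at x)"
  obtains r p where "\<And>x. x \<in> I \<Longrightarrow> f x = r * sin (c * x + p)"
    and "\<And>x. x \<in> I \<Longrightarrow> g x = r * cos (c * x + p)"
proof -
  \<comment> \<open>\<open>?u\<close> and \<open>?v\<close> are the imaginary and real parts of
    \<open>(g + i f) * exp (- i c x)\<close>.\<close>
  let ?u = "\<lambda>x. f x * cos (c * x) - g x * sin (c * x)"
  let ?v = "\<lambda>x. f x * sin (c * x) + g x * cos (c * x)"
  have "convex I" using \<open>is_interval I\<close> by (simp add: is_interval_convex_1)
  have "(?u has_field_derivative 0) (at x within I)" if "x \<in> I" for x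
    by (rule has_field_derivative_at_within)
      (auto intro!: derivative_eq_intros f[OF that] g[OF that] simp: algebra_simps)
  then obtain u where u: "\<And>x. x \<in> I \<Longrightarrow> ?u x = u"
    using has_field_derivative_zero_constant[OF \<open>convex I\<close>, of ?u] by blast
  have "(?v has_field_derivative 0) (at x within I)" if "x \<in> I" for x
    by (rule has_field_derivative_at_within)
      (auto intro!: derivative_eq_intros f[OF that] g[OF that] simp: algebra_simps)
  then obtain v where v: "\<And>x. x \<in> I \<Longrightarrow> ?v x = v"
    using has_field_derivative_zero_constant[OF \<open>convex I\<close>, of ?v] by blast
  define z where "z = Complex v u"
  define r where "r = cmod z"
  define p where "p = Arg z"
  have "z = rcis r p" unfolding r_def p_def by (simp add: rcis_cmod_Arg)
  then have vu: "v = r * cos p" "u = r * sin p"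
    by (auto simp: z_def complex_eq_iff)
  show thesis
  proof (rule that)
    fix x assume x: "x \<in> I"
    \<comment> \<open>Inverting the rotation, to recover \<open>f\<close> and \<open>g\<close> from
      \<open>u\<close> and \<open>v\<close>, needs only this identity.\<close>
    have sc: "sin (c * x) * sin (c * x) = 1 - cos (c * x) * cos (c * x)"
      using sin_cos_squared_add[of "c * x"] by (simp add: power2_eq_square)
    have "f x = u * cos (c * x) + v * sin (c * x)"
      unfolding u[OF x, symmetric] v[OF x, symmetric] using sc by algebra
    then show "f x = r * sin (c * x + p)"
      by (simp add: vu sin_add algebra_simps)
    have "g x = v * cos (c * x) - u * sin (c * x)"
      unfolding u[OF x, symmetric] v[OF x, symmetric] using sc by algebra
    then show "g x = r * cos (c * x + p)"
      by (simp add: vu cos_add algebra_simps)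
  qed
qed

section \<open>Classification of the solutions\<close>

lemma codazzi_solution_on_cases:
  assumes "c \<noteq> 0" and c: "c = 2 * lam" and "open I" and "is_interval I"
    and sol: "codazzi_solution_on c I a"
  shows "(\<forall>x\<in>I. a x = 0) \<or> (\<exists>c1 c2. general_form lam c1 c2 I a)"
proof -
  have smooth: "(deriv ^^ n) a field_differentiable at x" if "x \<in> I" for n x
    using sol that by (auto simp: codazzi_solution_on_def real_smooth_on_def)
  have a': "(a has_field_derivative deriv a x) (at x)" if "x \<in> I" for x
    using smooth[OF that, of 0] by (simp add: DERIV_deriv_iff_field_differentiable)
  have "(deriv a has_field_derivative deriv (deriv a) x) (at x)" if "x \<in> I" for x
    using smooth[OF that, of 1] by (simp add: DERIV_deriv_iff_field_differentiable)
  moreover have "deriv (deriv a) x = - 6 * a x * deriv a x - 4 * a x ^ 3 - c\<^sup>2 * a x"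
    if "x \<in> I" for x
    using sol that by (force simp: codazzi_solution_on_def)
  ultimately have a'': "(deriv a has_field_derivative
      - 6 * a x * deriv a x - 4 * a x ^ 3 - c\<^sup>2 * a x) (at x)" if "x \<in> I" for x
    using that by metis
  have "continuous_on I a"
    using a' by (meson DERIV_isCont continuous_at_imp_continuous_on)
  then obtain F where F: "\<And>x. x \<in> I \<Longrightarrow> (F has_field_derivative a x) (at x)"
    by (rule continuous_on_open_interval_antiderivative[OF \<open>open I\<close> \<open>is_interval I\<close>]) blast
  define D where "D x = exp (2 * F x)" for x
  have pos: "D x > 0" for x by (simp add: D_def)
  have D: "(D has_field_derivative 2 * a x * D x) (at x)" if "x \<in> I" for x
    unfolding D_def by (auto intro!: derivative_eq_intros F[OF that])
  \<comment> \<open>Here \<open>D' = 2 * a * D\<close> and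
    \<open>D'' = (2 * a' + 4 * a^2) * D\<close>. Dividing \<open>D''\<close> by \<open>c\<close>
    makes the pair \<open>D'\<close>, \<open>D'' / c\<close> a linear oscillator.\<close>
  have D1: "((\<lambda>x. 2 * a x * D x) has_field_derivative
      c * ((2 * deriv a x + 4 * (a x)\<^sup>2) * D x / c)) (at x)" if "x \<in> I" for x
    using \<open>c \<noteq> 0\<close> by (auto intro!: derivative_eq_intros D[OF that] a'[OF that]
        simp: field_simps power2_eq_square)
  \<comment> \<open>This is where the equation enters:
    \<open>D''' = (2 * a'' + 12 * a * a' + 8 * a^3) * D\<close>, which the equation turns into
    \<open>- 2 * c^2 * a * D\<close>.\<close>
  have D2: "((\<lambda>x. (2 * deriv a x + 4 * (a x)\<^sup>2) * D x / c) has_field_derivative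
      - c * (2 * a x * D x)) (at x)" if "x \<in> I" for x
    using \<open>c \<noteq> 0\<close> by (auto intro!: derivative_eq_intros D[OF that] a'[OF that] a''[OF that]
        simp: field_simps power2_eq_square power3_eq_cube)
  obtain r p where r: "\<And>x. x \<in> I \<Longrightarrow> 2 * a x * D x = r * sin (c * x + p)"
    by (rule linear_oscillator_phase_form[OF \<open>open I\<close> \<open>is_interval I\<close> D1 D2]) blast+
  \<comment> \<open>The constant of integration of \<open>D' = r * sin (c * x + p)\<close>.\<close>
  let ?k = "\<lambda>x. D x + r / c * cos (c * x + p)"
  have "(?k has_field_derivative 0) (at x within I)"
    if "x \<in> I" for x
  proof -
    have "((\<lambda>x. r / c * cos (c * x + p)) has_field_derivative - (r * sin (c * x + p))) (at x)"
      using \<open>c \<noteq> 0\<close> by (auto intro!: derivative_eq_intros)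
    from DERIV_add[OF D[OF that] this] have "(?k has_field_derivative 0) (at x)"
      by (simp add: r[OF that])
    then show ?thesis by (rule has_field_derivative_at_within)
  qed
  moreover have "convex I" using \<open>is_interval I\<close> by (simp add: is_interval_convex_1)
  ultimately obtain k where const: "\<And>x. x \<in> I \<Longrightarrow> ?k x = k"
    using has_field_derivative_zero_constant[of I ?k] by blast
  have k: "D x = k - r / c * cos (c * x + p)" if "x \<in> I" for x
    using const[OF that] by linarith
  show ?thesis
  proof (cases "r = 0")
    case True
    have "a x = 0" if "x \<in> I" for x
      using r[OF that] pos[of x] True by simp
    then show ?thesis by blast
  next
    case False
    \<comment> \<open>Factoring \<open>r / c\<close> out of
      \<open>D = k - r / c * cos (c * x + p)\<close> yields this value of \<open>c2\<close>. The
      denominator is then \<open>D * c / r\<close>, nonzero because \<open>D > 0\<close>.\<close>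
    have "general_form lam p (k * c / r) I a"
      unfolding general_form_def c[symmetric]
    proof
      fix x assume x: "x \<in> I"
      have eq: "k * c / r - cos (c * x + p) = D x * c / r"
        using False \<open>c \<noteq> 0\<close> by (simp add: k[OF x] field_simps)
      have "a x = r * sin (c * x + p) / (2 * D x)"
        using pos[of x] by (simp add: r[OF x, symmetric])
      then show "k * c / r - cos (c * x + p) \<noteq> 0 \<and>
          a x = lam * (sin (c * x + p) / (k * c / r - cos (c * x + p)))"
        unfolding eq using False \<open>c \<noteq> 0\<close> pos[of x] c by (simp add: field_simps)
    qed
    then show ?thesis by blast
  qed
qed

section \<open>Verification of the listed families, and completeness of the list\<close>

theorem theorem1p4:
  fixes c lam :: real and I :: "real set"
  assumes "c \<noteq> 0" and "c = 2 * lam" and "open_interval I"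
  shows "codazzi_solution_on c I (\<lambda>x. 0)
    \<and> (\<forall>K1 \<alpha>. special_form1 c K1 I \<alpha> \<longrightarrow> codazzi_solution_on c I \<alpha>)
    \<and> (\<forall>K2 \<alpha>. special_form2 c K2 I \<alpha> \<longrightarrow> codazzi_solution_on c I \<alpha>)
    \<and> (\<forall>c1 c2 \<alpha>. general_form lam c1 c2 I \<alpha> \<longrightarrow> codazzi_solution_on c I \<alpha>)
    \<and> (\<forall>\<alpha>. codazzi_solution_on c I \<alpha> \<longrightarrow>
          (\<forall>x\<in>I. \<alpha> x = 0)
        \<or> (\<exists>K1. special_form1 c K1 I \<alpha>)
        \<or> (\<exists>K2. special_form2 c K2 I \<alpha>)
        \<or> (\<exists>c1 c2. general_form lam c1 c2 I \<alpha>))"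
proof (intro conjI allI impI)
  have I: "open I" "is_interval I"
    using \<open>open_interval I\<close> by (auto simp: open_interval_def)
  show "codazzi_solution_on c I (\<lambda>x. 0)"
    by (rule codazzi_solution_onI[OF I(1), where b = "\<lambda>x. 0"]) auto
  show "codazzi_solution_on c I \<alpha>" if form: "special_form1 c K1 I \<alpha>" for K1 \<alpha>
  proof (rule codazzi_solution_on_log_derivative[OF I(1)])
    let ?t = "\<lambda>x. \<bar>c\<bar> * x + \<bar>c\<bar> * K1"
    show "((\<lambda>x. cos (?t x)) has_field_derivative - \<bar>c\<bar> * sin (?t x)) (at x)" for x
      by (auto intro!: derivative_eq_intros)
    show "((\<lambda>x. - \<bar>c\<bar> * sin (?t x)) has_field_derivative - c\<^sup>2 * cos (?t x)) (at x)" for x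
      by (auto intro!: derivative_eq_intros simp: power2_eq_square)
    show "((\<lambda>x. - c\<^sup>2 * cos (?t x)) has_field_derivative - c\<^sup>2 * (- \<bar>c\<bar> * sin (?t x))) (at x)" for x
      by (auto intro!: derivative_eq_intros)
    show "cos (?t x) \<noteq> 0" "\<alpha> x = - \<bar>c\<bar> * sin (?t x) / (2 * cos (?t x))" if "x \<in> I" for x
      using form that by (auto simp: special_form1_def tan_def)
  qed
  show "codazzi_solution_on c I \<alpha>" if form: "special_form2 c K2 I \<alpha>" for K2 \<alpha>
  proof (rule codazzi_solution_on_log_derivative[OF I(1)])
    let ?t = "\<lambda>x. - (\<bar>c\<bar> / 2) * x + (\<bar>c\<bar> / 2) * K2"
    have abs_c: "\<bar>c\<bar> * (\<bar>c\<bar> * y) = c * (c * y)" for y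
      by (simp add: mult.assoc[symmetric])
    \<comment> \<open>The square doubles the frequency: \<open>?t\<close> has slope
      \<open>- \<bar>c\<bar> / 2\<close>, while \<open>cos^2 = (1 + cos (2 * ?t)) / 2\<close>
      oscillates with frequency \<open>\<bar>c\<bar>\<close>, as \<open>D''' = - c^2 * D'\<close>
      requires.\<close>
    show "((\<lambda>x. (cos (?t x))\<^sup>2) has_field_derivative \<bar>c\<bar> * (sin (?t x) * cos (?t x))) (at x)" for x
      by (auto intro!: derivative_eq_intros)
    show "((\<lambda>x. \<bar>c\<bar> * (sin (?t x) * cos (?t x))) has_field_derivative
        c\<^sup>2 / 2 * ((sin (?t x))\<^sup>2 - (cos (?t x))\<^sup>2)) (at x)" for x
      by (auto intro!: derivative_eq_intros simp: power2_eq_square algebra_simps abs_c)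
    show "((\<lambda>x. c\<^sup>2 / 2 * ((sin (?t x))\<^sup>2 - (cos (?t x))\<^sup>2)) has_field_derivative
        - c\<^sup>2 * (\<bar>c\<bar> * (sin (?t x) * cos (?t x)))) (at x)" for x
      by (auto intro!: derivative_eq_intros simp: algebra_simps)
    show "(cos (?t x))\<^sup>2 \<noteq> 0" "\<alpha> x = \<bar>c\<bar> * (sin (?t x) * cos (?t x)) / (2 * (cos (?t x))\<^sup>2)"
      if "x \<in> I" for x
      using form that by (auto simp: special_form2_def tan_def power2_eq_square)
  qed
  show "codazzi_solution_on c I \<alpha>" if form: "general_form lam c1 c2 I \<alpha>" for c1 c2 \<alpha>
  proof (rule codazzi_solution_on_log_derivative[OF I(1)])
    let ?t = "\<lambda>x. c * x + c1"
    show "((\<lambda>x. c2 - cos (?t x)) has_field_derivative c * sin (?t x)) (at x)" for x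
      by (auto intro!: derivative_eq_intros)
    show "((\<lambda>x. c * sin (?t x)) has_field_derivative c\<^sup>2 * cos (?t x)) (at x)" for x
      by (auto intro!: derivative_eq_intros simp: power2_eq_square)
    show "((\<lambda>x. c\<^sup>2 * cos (?t x)) has_field_derivative - c\<^sup>2 * (c * sin (?t x))) (at x)" for x
      by (auto intro!: derivative_eq_intros)
    have half: "lam * (s / d) = c * s / (2 * d)" for s d
      using \<open>c = 2 * lam\<close> by simp
    show "c2 - cos (?t x) \<noteq> 0" if "x \<in> I" for x
      using form that \<open>c = 2 * lam\<close> by (auto simp: general_form_def)
    show "\<alpha> x = c * sin (?t x) / (2 * (c2 - cos (?t x)))" if "x \<in> I" for x
    proof -
      have "\<alpha> x = lam * (sin (?t x) / (c2 - cos (?t x)))"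
        using form that \<open>c = 2 * lam\<close> by (simp add: general_form_def)
      then show ?thesis
        using half by simp
    qed
  qed
  \<comment> \<open>Only the first and last alternatives have to be produced: the special forms are
    the general form at \<open>c2 = 0\<close> and \<open>c2 = -1\<close>, for suitable
    \<open>c1\<close>.\<close>
  show "(\<forall>x\<in>I. \<alpha> x = 0) \<or> (\<exists>K1. special_form1 c K1 I \<alpha>) \<or> (\<exists>K2. special_form2 c K2 I \<alpha>)
      \<or> (\<exists>c1 c2. general_form lam c1 c2 I \<alpha>)" if "codazzi_solution_on c I \<alpha>" for \<alpha>
    using codazzi_solution_on_cases[OF assms(1,2) I that] by blast
qed

end
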